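(* Let $f:\mathbb{R}^n\to\mathbb{R}$ and $g:\mathbb{R}^m\to\mathbb{R}$ satisfy $f\in\mathcal{S}(0,\beta_f)$ and $g\in\mathcal{S}(\mu_g,\beta_g)$ with $0<\mu_g\le\beta_g$, and let $A\in\mathbb{R}^{m\times n}$ have full column rank. Let $c_1,c_2,c_3\in\mathbb{R}$, $\eta_2>0$, and (with $I$ the $m\times m$ identity) $$A_{\mathrm{io}}=\begin{bmatrix}(1+c_1)I & -c_1I\\ I & 0\end{bmatrix},\quad B_{\mathrm{io}}=\begin{bmatrix}-\eta_2I\\ 0\end{bmatrix},\quad C_{\mathrm{io}}=\begin{bmatrix}(1+c_2)I & -c_2I\end{bmatrix},\quad E_{\mathrm{io}}=\begin{bmatrix}(1+c_3)I & -c_3I\end{bmatrix}.$$ Assume there exist a positive definite matrix $P\in\mathbb{R}^{2m\times 2m}$ and $\rho_2\in[0,1)$ such that $$\|A_{\mathrm{io}}\xi+B_{\mathrm{io}}w\|_P\le\rho_2\|\xi\|_P$$ for all $\xi\in\mathbb{R}^{2m}$ and all $w\in\mathbb{R}^m$ satisfying $(C_{\mathrm{io}}\xi,w)\in\mathsf{sec}(\mu_g,\beta_g)$. Consider the recursion, for $k\ge0$, $$x^{k+1}=x^k-\eta_1\left(\nabla f(x^k)+A^Ty^k\right),$$ $$\xi^{k+1}=A_{\mathrm{io}}\xi^k+B_{\mathrm{io}}\left[\nabla g(v^k)-Ax^k\right],\qquad v^k=C_{\mathrm{io}}\xi^k,\qquad y^k=E_{\mathrm{io}}\xi^k.$$ Then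 there exists a step size $\eta_1>0$ such that, for all initial conditions $x^0\in\mathbb{R}^n$, $\xi^0\in\mathbb{R}^{2m}$, the sequences $\{x^k\}$ and $\{y^k\}$ converge exponentially to the primal and dual optimal solutions $x^\star$ and $y^\star$, respectively.
   Context: For $\mu\ge 0$ and $\beta>0$, $\mathcal{S}(\mu,\beta)$ denotes the set of real-valued differentiable functions on a Euclidean space that are $\mu$-strongly convex and $\beta$-smooth (i.e. with $\beta$-Lipschitz gradient); $\mathcal{S}(0,\beta)$ denotes the set of convex $\beta$-smooth functions. For positive definite $P$, $\|x\|_P=(x^TPx)^{1/2}$. The sector constraint set is $$\mathsf{sec}(\mu,\beta)=\left\{(v,w):\ \begin{bmatrix}v \\ w\end{bmatrix}^T\begin{bmatrix}-2\mu\beta I&(\mu+\beta)I\\ (\mu+\beta)I&-2I\end{bmatrix}\begin{bmatrix}v \\ w\end{bmatrix}\ge 0\right\},$$ where $v,w$ are vectors of equal dimension. The minimax problem is $\min_{x\in\mathbb{R}^n}\max_{y\in\mathbb{R}^m}L(x,y)$ with $L(x,y)=f(x)+y^TAx-g(y)$. The primal problem is to minimize $p(x)=\max_y L(x,y)$ over $x\in\mathbb{R}^n$; the dual problem is to maximize $d(y)=\min_x L(x,y)$ over $y\in\mathbb{R}^m$ (with $\min$ understood as infimum). Under the stated assumptions the primal and dual optimal solutions are unique; they are denoted $x^\star$ and $y^\star$. A sequence $\{z^k\}$ converges exponentially to $z^\star$ if there are $C\ge 0$ and $r\in[0,1)$ with $\|z^k-z^\star\|\le Cr^k$ for all $k\ge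 0$. *)

theory Defs
  imports "HOL-Analysis.Analysis"
begin

section \<open>Block vectors and block matrices\<close>

text \<open>The index type \<^typ>\<open>'m + 'n\<close> is the disjoint union of the two index types, so that
  \<^typ>\<open>real^('m + 'm)\<close> plays the role of the space of real vectors of length $2m$.\<close>

definition stack :: "'a^'m \<Rightarrow> 'a^'n \<Rightarrow> 'a^('m + 'n)" where
  "stack v w = (\<chi> i. case i of Inl j \<Rightarrow> v $ j | Inr j \<Rightarrow> w $ j)"

definition row_block :: "'a^'m^'k \<Rightarrow> 'a^'n^'k \<Rightarrow> 'a^('m + 'n)^'k" where
  "row_block M N = (\<chi> i. stack (M $ i) (N $ i))"

definition col_block :: "'a^'k^'m \<Rightarrow> 'a^'k^'n \<Rightarrow> 'a^'k^('m + 'n)" where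
  "col_block M N = stack M N"

definition block_matrix ::
  "'a^'m^'k \<Rightarrow> 'a^'n^'k \<Rightarrow> 'a^'m^'l \<Rightarrow> 'a^'n^'l \<Rightarrow> 'a^('m + 'n)^('k + 'l)" where
  "block_matrix A B C D = col_block (row_block A B) (row_block C D)"

lemma sum_UNIV_plus:
  fixes h :: "'m::finite + 'n::finite \<Rightarrow> 'b::comm_monoid_add"
  shows "sum h UNIV = (\<Sum>i\<in>UNIV. h (Inl i)) + (\<Sum>i\<in>UNIV. h (Inr i))"
  by (subst UNIV_Plus_UNIV[symmetric], subst sum.Plus) simp_all

lemma row_block_mult_stack:
  fixes M :: "real^'m^'k" and N :: "real^'n^'k"
  shows "row_block M N *v stack v w = M *v v + N *v w"
  by (simp add: vec_eq_iff row_block_def stack_def matrix_vector_mult_def sum_UNIV_plus)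

lemma col_block_mult:
  fixes M :: "real^'k^'m" and N :: "real^'k^'n"
  shows "col_block M N *v v = stack (M *v v) (N *v v)"
  by (simp add: vec_eq_iff col_block_def stack_def matrix_vector_mult_def split: sum.split)

lemma block_matrix_mult_stack:
  fixes A :: "real^'m^'k" and D :: "real^'n^'l"
  shows "block_matrix A B C D *v stack v w = stack (A *v v + B *v w) (C *v v + D *v w)"
  by (simp add: block_matrix_def col_block_mult row_block_mult_stack)

definition pos_definite :: "real^'n^'n \<Rightarrow> bool" where
  "pos_definite P \<longleftrightarrow> transpose P = P \<and> (\<forall>x. x \<noteq> 0 \<longrightarrow> 0 < x \<bullet> (P *v x))"

definition norm_wrt :: "real^'n^'n \<Rightarrow> real^'n \<Rightarrow> real" where
  "norm_wrt P x = sqrt (x \<bullet> (P *v x))"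

section \<open>Function classes and the sector constraint\<close>

definition grad :: "('a::real_inner \<Rightarrow> real) \<Rightarrow> 'a \<Rightarrow> 'a" where
  "grad f x = (THE D. GDERIV f x :> D)"

lemma grad_eqI:
  assumes "GDERIV f x :> D"
  shows "grad f x = D"
  unfolding grad_def
proof (rule the_equality, rule assms)
  fix D' assume "GDERIV f x :> D'"
  with assms have "(\<lambda>h. h \<bullet> D') = (\<lambda>h. h \<bullet> D)"
    unfolding gderiv_def by (rule has_derivative_unique[rotated])
  then show "D' = D"
    by (metis vector_eq_rdot inner_commute)
qed

lemma GDERIV_grad:
  fixes f :: "'a::euclidean_space \<Rightarrow> real"
  assumes "f differentiable (at x)"
  shows "GDERIV f x :> grad f x"
proof -
  from assms obtain f' where f': "(f has_derivative f') (at x)"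
    unfolding differentiable_def by blast
  have "f' = (\<lambda>h. h \<bullet> adjoint f' 1)"
    using adjoint_works[OF has_derivative_linear[OF f']] by (metis inner_real_def mult.right_neutral)
  with f' have "GDERIV f x :> adjoint f' 1"
    unfolding gderiv_def by metis
  then show ?thesis
    using grad_eqI by metis
qed

definition strongly_convex :: "real \<Rightarrow> ('a::real_inner \<Rightarrow> real) \<Rightarrow> bool" where
  "strongly_convex \<mu> f \<longleftrightarrow> convex_on UNIV (\<lambda>x. f x - \<mu> / 2 * (norm x)\<^sup>2)"

definition S_class :: "real \<Rightarrow> real \<Rightarrow> ('a::euclidean_space \<Rightarrow> real) set" where
  "S_class \<mu> \<beta> = {f. (\<forall>x. f differentiable (at x)) \<and> strongly_convex \<mu> f \<and>
                      \<beta>-lipschitz_on UNIV (grad f)}"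

text \<open>Recall that \<^term>\<open>mat c\<close> is $c$ times the identity matrix.\<close>

definition sec :: "real \<Rightarrow> real \<Rightarrow> ((real^'n) \<times> (real^'n)) set" where
  "sec \<mu> \<beta> = {(v, w).
     stack v w \<bullet> (block_matrix (mat (- 2 * \<mu> * \<beta>)) (mat (\<mu> + \<beta>))
                              (mat (\<mu> + \<beta>)) (mat (- 2)) *v stack v w) \<ge> 0}"

section \<open>The minimax problem\<close>

definition Lagr ::
  "(real^'n \<Rightarrow> real) \<Rightarrow> (real^'m \<Rightarrow> real) \<Rightarrow> real^'n^'m \<Rightarrow> real^'n \<Rightarrow> real^'m \<Rightarrow> real" where
  "Lagr f g A x y = f x + y \<bullet> (A *v x) - g y"

text \<open>The infimum defining the dual function may be $-\infty$ when \<^term>\<open>f\<close> is merely convex,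
  hence the extended reals.\<close>

definition primal_fun ::
  "(real^'n \<Rightarrow> real) \<Rightarrow> (real^'m \<Rightarrow> real) \<Rightarrow> real^'n^'m \<Rightarrow> real^'n \<Rightarrow> ereal" where
  "primal_fun f g A x = (SUP y. ereal (Lagr f g A x y))"

definition dual_fun ::
  "(real^'n \<Rightarrow> real) \<Rightarrow> (real^'m \<Rightarrow> real) \<Rightarrow> real^'n^'m \<Rightarrow> real^'m \<Rightarrow> ereal" where
  "dual_fun f g A y = (INF x. ereal (Lagr f g A x y))"

definition primal_optimal ::
  "(real^'n \<Rightarrow> real) \<Rightarrow> (real^'m \<Rightarrow> real) \<Rightarrow> real^'n^'m \<Rightarrow> real^'n \<Rightarrow> bool" where
  "primal_optimal f g A x \<longleftrightarrow> (\<forall>x'. primal_fun f g A x \<le> primal_fun f g A x')"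

definition dual_optimal ::
  "(real^'n \<Rightarrow> real) \<Rightarrow> (real^'m \<Rightarrow> real) \<Rightarrow> real^'n^'m \<Rightarrow> real^'m \<Rightarrow> bool" where
  "dual_optimal f g A y \<longleftrightarrow> (\<forall>y'. dual_fun f g A y' \<le> dual_fun f g A y)"

section \<open>The algorithm\<close>

definition A_io :: "real \<Rightarrow> real^('m::finite + 'm)^('m + 'm)" where
  "A_io c1 = block_matrix (mat (1 + c1)) (mat (- c1)) (mat 1) (mat 0)"

definition B_io :: "real \<Rightarrow> real^'m^('m + 'm)" where
  "B_io \<eta>2 = col_block (mat (- \<eta>2)) (mat 0)"

definition C_io :: "real \<Rightarrow> real^('m + 'm)^'m" where
  "C_io c2 = row_block (mat (1 + c2)) (mat (- c2))"

definition E_io :: "real \<Rightarrow> real^('m + 'm)^'m" where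
  "E_io c3 = row_block (mat (1 + c3)) (mat (- c3))"

definition converges_exponentially :: "(nat \<Rightarrow> 'a::real_normed_vector) \<Rightarrow> 'a \<Rightarrow> bool" where
  "converges_exponentially z zs \<longleftrightarrow>
     (\<exists>C r. 0 \<le> C \<and> 0 \<le> r \<and> r < 1 \<and> (\<forall>k. norm (z k - zs) \<le> C * r ^ k))"

end

theory Submission
  imports Defs
begin

text \<open>Let $\varphi$ be the inverse of $\nabla g$. The primal function has gradient
  $F(x) = \nabla f(x) + A^T \varphi(Ax)$, which is Lipschitz and, by cocoercivity of $\nabla g$
  and the full column rank of $A$, strongly monotone. The stacked vector $(\varphi(Ax), \varphi(Ax))$ is a fixed
  point of the inner iteration run with $x$ frozen, and cocoercivity places the deviation from it in
  the sector, so one inner step shrinks the tracking error in the $P$-norm by the factor $\rho_2$.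
  The $x$-update is a gradient step on the primal function perturbed by the tracking error, and it
  moves the target of the inner iteration only by $O(\eta_1)$ times the two errors. Hence for small
  $\eta_1$ a weighted sum of the distance to the optimum and the tracking error contracts.\<close>

section \<open>Quadratic bounds and cocoercivity for smooth strongly convex functions\<close>

text \<open>The descent lemma. The excess \<open>\<psi>\<close> of \<open>f\<close> over its
  quadratic model at \<open>x\<close>, taken along the segment towards \<open>y\<close>, has
  nonpositive derivative by Cauchy-Schwarz and the Lipschitz bound.\<close>

lemma S_class_upper_bound:
  fixes f :: "'a::euclidean_space \<Rightarrow> real"
  assumes "f \<in> S_class \<mu> \<beta>"
  shows "f y \<le> f x + grad f x \<bullet> (y - x) + \<beta> / 2 * (norm (y - x))\<^sup>2"
proof -
  define d where "d = y - x"
  have diff: "GDERIV f z :> grad f z" for z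
    using assms GDERIV_grad by (auto simp: S_class_def)
  have lip: "norm (grad f z - grad f x) \<le> \<beta> * norm (z - x)" for z
    using assms lipschitz_onD[of \<beta> UNIV "grad f" z x] by (auto simp: S_class_def dist_norm)
  define \<psi> where "\<psi> t = f (x + t *\<^sub>R d) - t * (grad f x \<bullet> d) - \<beta> / 2 * t\<^sup>2 * (norm d)\<^sup>2" for t
  have der: "(\<psi> has_real_derivative
      (d \<bullet> grad f (x + t *\<^sub>R d) - grad f x \<bullet> d - \<beta> * t * (norm d)\<^sup>2)) (at t)" for t
  proof -
    have "((\<lambda>t. f (x + t *\<^sub>R d)) has_derivative (\<lambda>s. (s *\<^sub>R d) \<bullet> grad f (x + t *\<^sub>R d))) (at t)"
      by (rule has_derivative_compose[of "\<lambda>t. x + t *\<^sub>R d" _ _ _ f, OF _ diff[unfolded gderiv_def]])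
        (auto intro!: derivative_eq_intros)
    then have "((\<lambda>t. f (x + t *\<^sub>R d)) has_real_derivative d \<bullet> grad f (x + t *\<^sub>R d)) (at t)"
      by (simp add: has_field_derivative_def mult.commute[of _ "d \<bullet> _"])
    then show ?thesis unfolding \<psi>_def
      by (auto intro!: derivative_eq_intros)
  qed
  have "\<psi> 1 \<le> \<psi> 0"
  proof (rule DERIV_nonpos_imp_nonincreasing[where f = \<psi>])
    fix t :: real assume t: "0 \<le> t"
    have "d \<bullet> grad f (x + t *\<^sub>R d) - grad f x \<bullet> d = d \<bullet> (grad f (x + t *\<^sub>R d) - grad f x)"
      by (simp add: inner_diff_right inner_commute)
    also have "\<dots> \<le> norm d * norm (grad f (x + t *\<^sub>R d) - grad f x)"
      by (rule norm_cauchy_schwarz)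
    also have "\<dots> \<le> norm d * (\<beta> * (t * norm d))"
      using lip[of "x + t *\<^sub>R d"] t by (intro mult_left_mono) auto
    finally have "d \<bullet> grad f (x + t *\<^sub>R d) - grad f x \<bullet> d - \<beta> * t * (norm d)\<^sup>2 \<le> 0"
      by (simp add: power2_eq_square mult_ac)
    then show "\<exists>y. (\<psi> has_real_derivative y) (at t) \<and> y \<le> 0" using der by blast
  qed simp
  then show ?thesis by (simp add: \<psi>_def d_def)
qed

text \<open>Subtracting the quadratic leaves a convex \<open>h\<close>, which lies above its
  tangents. Restricting \<open>h\<close> to the line through \<open>x\<close> and \<open>y\<close>
  reduces this to the one-dimensional tangent inequality.\<close>

lemma S_class_lower_bound:
  fixes f :: "'a::euclidean_space \<Rightarrow> real"
  assumes "f \<in> S_class \<mu> \<beta>"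
  shows "f x + grad f x \<bullet> (y - x) + \<mu> / 2 * (norm (y - x))\<^sup>2 \<le> f y"
proof -
  define d where "d = y - x"
  define h where "h z = f z - \<mu> / 2 * (norm z)\<^sup>2" for z
  have diff: "GDERIV f z :> grad f z" for z
    using assms GDERIV_grad by (auto simp: S_class_def)
  have conv: "convex_on UNIV h"
    using assms by (simp add: S_class_def strongly_convex_def h_def[abs_def])
  have conv': "convex_on UNIV (\<lambda>t. h (x + t *\<^sub>R d))"
  proof (rule convex_onI)
    fix t a b :: real assume "0 < t" "t < 1"
    have "x + ((1 - t) *\<^sub>R a + t *\<^sub>R b) *\<^sub>R d = (1 - t) *\<^sub>R (x + a *\<^sub>R d) + t *\<^sub>R (x + b *\<^sub>R d)"
      by (simp add: algebra_simps)
    then show "h (x + ((1 - t) *\<^sub>R a + t *\<^sub>R b) *\<^sub>R d)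
        \<le> (1 - t) * h (x + a *\<^sub>R d) + t * h (x + b *\<^sub>R d)"
      using convex_onD[OF conv, of t "x + a *\<^sub>R d" "x + b *\<^sub>R d"] \<open>0 < t\<close> \<open>t < 1\<close> by simp
  qed simp
  have "(h has_derivative (\<lambda>k. k \<bullet> (grad f x - \<mu> *\<^sub>R x))) (at (x + 0 *\<^sub>R d))"
    unfolding h_def power2_norm_eq_inner using diff[of x, unfolded gderiv_def]
    by (auto intro!: derivative_eq_intros simp: algebra_simps inner_commute)
  moreover have "((\<lambda>t. x + t *\<^sub>R d) has_derivative (\<lambda>s. s *\<^sub>R d)) (at 0)"
    by (auto intro!: derivative_eq_intros)
  ultimately have "((\<lambda>t. h (x + t *\<^sub>R d)) has_derivative (\<lambda>s. (s *\<^sub>R d) \<bullet> (grad f x - \<mu> *\<^sub>R x))) (at 0)"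
    by (rule has_derivative_compose[rotated])
  then have "((\<lambda>t. h (x + t *\<^sub>R d)) has_real_derivative d \<bullet> (grad f x - \<mu> *\<^sub>R x)) (at 0)"
    by (simp add: has_field_derivative_def mult.commute[of _ "d \<bullet> _"])
  from convex_on_imp_above_tangent[OF conv' _ _ _ this[THEN has_field_derivative_at_within], of 1]
  have "h (x + d) - h x \<ge> d \<bullet> (grad f x - \<mu> *\<^sub>R x)" by simp
  then show ?thesis
    by (simp add: h_def d_def power2_norm_eq_inner algebra_simps inner_commute)
qed

text \<open>This is the quadratic inequality behind \<open>sec \<mu> \<beta>\<close>, for gradient
  differences. It gives access to the contraction assumption on the inner iteration and also yields
  the strong monotonicity of the primal gradient.\<close>

lemma S_class_cocoercive:
  fixes f :: "'a::euclidean_space \<Rightarrow> real"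
  assumes f: "f \<in> S_class \<mu> \<beta>" and "\<mu> \<le> \<beta>"
  defines "G x y \<equiv> grad f x - grad f y"
  shows "G x y \<bullet> G x y \<le> (\<mu> + \<beta>) * (G x y \<bullet> (x - y)) - \<mu> * \<beta> * ((x - y) \<bullet> (x - y))"
proof -
  \<comment> \<open>The gradient difference of the convex function \<^term>\<open>\<lambda>x. f x - \<mu> / 2 * (norm x)\<^sup>2\<close>;
    the step of length \<^term>\<open>1 / B\<close> from \<^term>\<open>y\<close> below is the Baillon--Haddad argument for it.\<close>
  define \<Delta> where "\<Delta> x y = G x y - \<mu> *\<^sub>R (x - y)" for x y
  have *: "f x - f y + grad f x \<bullet> (y - x) + \<mu> / 2 * ((y - x) \<bullet> (y - x)) \<le> - (\<Delta> y x \<bullet> \<Delta> y x) / (2 * B)"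
    if B: "0 < B" "\<beta> - \<mu> \<le> B" for B x y
  proof -
    define t where "t = 1 / B"
    have t: "0 < t" "t * (\<beta> - \<mu>) \<le> 1" using B by (auto simp: t_def)
    define e where "e = \<Delta> y x"
    define z where "z = y - t *\<^sub>R e"
    \<comment> \<open>The lower model at \<open>x\<close> and the upper model at \<open>y\<close>
      are compared at the trial point \<open>z\<close>, which eliminates \<open>f z\<close>.\<close>
    have "f x + grad f x \<bullet> (z - x) + \<mu> / 2 * (norm (z - x))\<^sup>2 \<le> f y + grad f y \<bullet> (z - y) + \<beta> / 2 * (norm (z - y))\<^sup>2"
      using S_class_upper_bound[OF f, of z y] S_class_lower_bound[OF f, of x z] by linarith
    moreover have "grad f y = grad f x + e + \<mu> *\<^sub>R (y - x)"
      by (simp add: e_def \<Delta>_def G_def)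
    ultimately have "f x - f y + grad f x \<bullet> (y - x) + \<mu> / 2 * ((y - x) \<bullet> (y - x))
        \<le> - t * (e \<bullet> e) + (t * (\<beta> - \<mu>)) * (t / 2 * (e \<bullet> e))"
      unfolding power2_norm_eq_inner
      by (simp add: z_def algebra_simps inner_commute power2_eq_square)
    also have "\<dots> \<le> - t * (e \<bullet> e) + 1 * (t / 2 * (e \<bullet> e))"
      using t by (intro add_left_mono mult_right_mono) auto
    finally show ?thesis by (simp add: t_def e_def)
  qed
  define N where "N = \<Delta> x y \<bullet> \<Delta> x y"
  define D where "D = \<Delta> x y \<bullet> (x - y)"
  have **: "N \<le> B * D" if B: "0 < B" "\<beta> - \<mu> \<le> B" for B
  proof -
    have "\<Delta> y x = - \<Delta> x y" by (simp add: \<Delta>_def G_def algebra_simps)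
    \<comment> \<open>Adding both orderings cancels the function values; each contributes half of
      \<open>N / B\<close>.\<close>
    then have "grad f x \<bullet> (y - x) + grad f y \<bullet> (x - y) + \<mu> * ((x - y) \<bullet> (x - y)) \<le> - (N / B)"
      using *[OF B, of x y] *[OF B, of y x]
      by (simp add: N_def inner_diff_left inner_diff_right inner_commute field_simps)
    moreover have "grad f x \<bullet> (y - x) + grad f y \<bullet> (x - y) + \<mu> * ((x - y) \<bullet> (x - y)) = - D"
      by (simp add: D_def \<Delta>_def G_def algebra_simps inner_commute)
    ultimately have "N / B \<le> D" by linarith
    then show ?thesis using B(1) by (simp add: pos_divide_le_eq mult.commute)
  qed
  \<comment> \<open>The limit handles \<^term>\<open>\<beta> = \<mu>\<close>, where \<^term>\<open>1 / B\<close> is not available.\<close>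
  have "N \<le> (\<beta> - \<mu>) * D"
  proof (rule tendsto_lowerbound)
    show "((\<lambda>B. B * D) \<longlongrightarrow> (\<beta> - \<mu>) * D) (at_right (\<beta> - \<mu>))"
      by (auto intro!: tendsto_intros)
    show "\<forall>\<^sub>F B in at_right (\<beta> - \<mu>). N \<le> B * D"
      using ** \<open>\<mu> \<le> \<beta>\<close> by (auto intro!: eventually_at_rightI[of _ "\<beta> - \<mu> + 1"])
  qed simp
  then show ?thesis
    by (simp add: N_def D_def \<Delta>_def algebra_simps inner_commute)
qed

section \<open>Gradient steps and solvability for strongly monotone Lipschitz maps\<close>

text \<open>Expanding the square gives the factor
  \<open>1 - 2 * \<eta> * m + \<eta>\<^sup>2 * L\<^sup>2\<close>. The bound on \<open>\<eta>\<close>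
  absorbs the last term into \<open>\<eta> * m\<close>, and \<open>1 - \<eta> * m\<close> is at most
  the square of \<open>1 - \<eta> * m / 2\<close>.\<close>

lemma gradient_step_contraction:
  fixes F :: "'a::real_inner \<Rightarrow> 'a"
  assumes mono: "m * (norm (x - y))\<^sup>2 \<le> (F x - F y) \<bullet> (x - y)"
    and lip: "norm (F x - F y) \<le> L * norm (x - y)"
    and "0 < m" "m \<le> L" "0 < \<eta>" "\<eta> \<le> m / L\<^sup>2"
  shows "norm ((x - \<eta> *\<^sub>R F x) - (y - \<eta> *\<^sub>R F y)) \<le> (1 - \<eta> * m / 2) * norm (x - y)"
proof -
  define d where "d = x - y"
  define e where "e = F x - F y"
  have L: "0 < L" using assms by simp
  have \<eta>L: "\<eta> * L\<^sup>2 \<le> m" using assms L by (simp add: field_simps)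
  \<comment> \<open>Keeps \<open>1 - \<eta> * m / 2\<close> nonnegative, so that the squares can be
    removed at the end.\<close>
  have "\<eta> * m \<le> 1"
  proof -
    have "\<eta> * m * L\<^sup>2 \<le> m * m" using \<eta>L \<open>0 < m\<close> by (simp add: mult_ac)
    also have "\<dots> \<le> 1 * L\<^sup>2" using assms by (simp add: power2_eq_square mult_mono)
    finally show ?thesis using L by (metis mult_le_cancel_right_pos zero_less_power)
  qed
  have "(norm (d - \<eta> *\<^sub>R e))\<^sup>2 = (norm d)\<^sup>2 - 2 * \<eta> * (e \<bullet> d) + \<eta>\<^sup>2 * (norm e)\<^sup>2"
    unfolding power2_norm_eq_inner by (simp add: algebra_simps inner_commute power2_eq_square)
  also have "\<dots> \<le> (norm d)\<^sup>2 - 2 * \<eta> * (m * (norm d)\<^sup>2) + \<eta>\<^sup>2 * (L * norm d)\<^sup>2"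
    using mono lip \<open>0 < \<eta>\<close> by (intro add_mono diff_mono mult_left_mono power_mono) (auto simp: d_def e_def)
  also have "\<dots> = (norm d)\<^sup>2 - 2 * \<eta> * (m * (norm d)\<^sup>2) + (\<eta> * L\<^sup>2) * (\<eta> * (norm d)\<^sup>2)"
    by (simp add: power2_eq_square)
  also have "\<dots> \<le> (norm d)\<^sup>2 - 2 * \<eta> * (m * (norm d)\<^sup>2) + m * (\<eta> * (norm d)\<^sup>2)"
    using \<eta>L \<open>0 < \<eta>\<close> by (intro add_left_mono mult_right_mono) auto
  also have "\<dots> \<le> ((1 - \<eta> * m / 2) * norm d)\<^sup>2"
  proof -
    have "1 - \<eta> * m \<le> (1 - \<eta> * m / 2)\<^sup>2" by (simp add: power2_diff)
    from mult_right_mono[OF this, of "(norm d)\<^sup>2"] show ?thesis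
      unfolding power_mult_distrib by (simp add: left_diff_distrib)
  qed
  finally have "norm (d - \<eta> *\<^sub>R e) \<le> (1 - \<eta> * m / 2) * norm d"
    by (rule power2_le_imp_le) (rule mult_nonneg_nonneg, use \<open>\<eta> * m \<le> 1\<close> in simp_all)
  then show ?thesis by (simp add: d_def e_def algebra_simps)
qed

text \<open>The damped step \<open>T\<close> is a Banach contraction whose fixed points solve
  \<open>F x = b\<close>. This serves twice: to invert \<open>grad g\<close> and to find the primal
  optimum.\<close>

lemma strongly_monotone_surj:
  fixes F :: "'a::{real_inner, complete_space} \<Rightarrow> 'a"
  assumes mono: "\<And>x y. m * (norm (x - y))\<^sup>2 \<le> (F x - F y) \<bullet> (x - y)"
    and lip: "\<And>x y. norm (F x - F y) \<le> L * norm (x - y)"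
    and "0 < m"
  obtains x where "F x = b"
proof -
  \<comment> \<open>Enlarging the Lipschitz constant supplies \<open>m \<le> K\<close>, as
    \<open>gradient_step_contraction\<close> requires.\<close>
  define K where "K = max L m"
  define \<eta> where "\<eta> = m / K\<^sup>2"
  have K: "0 < K" "m \<le> K" using \<open>0 < m\<close> by (auto simp: K_def)
  have \<eta>: "0 < \<eta>" using K \<open>0 < m\<close> by (simp add: \<eta>_def)
  have lip': "norm (F x - F y) \<le> K * norm (x - y)" for x y
    by (rule order_trans[OF lip]) (auto simp: K_def intro!: mult_right_mono)
  define T where "T x = x - \<eta> *\<^sub>R (F x - b)" for x
  have contr: "dist (T x) (T y) \<le> (1 - \<eta> * m / 2) * dist x y" for x y
    using gradient_step_contraction[of m x y "\<lambda>x. F x - b" K \<eta>] mono lip' \<open>0 < m\<close> K \<eta>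
    by (simp add: dist_norm T_def \<eta>_def)
  have "\<eta> * m \<le> 1"
    using K \<open>0 < m\<close> by (simp add: \<eta>_def power2_eq_square field_simps mult_mono)
  then have "\<exists>!x. T x = x"
    using contr \<eta> \<open>0 < m\<close> by (intro banach_fix_type[of "1 - \<eta> * m / 2"]) auto
  then show thesis using that \<eta> by (auto simp: T_def)
qed

section \<open>The norm induced by a positive definite matrix\<close>

lemma pos_definite_inner_nonneg:
  "pos_definite P \<Longrightarrow> 0 \<le> x \<bullet> (P *v x)"
  unfolding pos_definite_def by (cases "x = 0") (auto intro: less_imp_le)

lemma norm_wrt_nonneg: "pos_definite P \<Longrightarrow> 0 \<le> norm_wrt P x"
  by (simp add: norm_wrt_def pos_definite_inner_nonneg)

text \<open>Subadditivity follows from Cauchy-Schwarz for the symmetric form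
  \<open>q\<close>.\<close>

lemma norm_wrt_triangle:
  assumes P: "pos_definite P"
  shows "norm_wrt P (x + y) \<le> norm_wrt P x + norm_wrt P y"
proof -
  define q where "q x y = x \<bullet> (P *v y)" for x y
  have sym: "q x y = q y x" for x y
  proof -
    have "q x y = (x v* transpose P) \<bullet> y"
      using P by (simp add: q_def pos_definite_def dot_lmul_matrix)
    then show ?thesis by (simp add: q_def inner_commute)
  qed
  have nn: "0 \<le> q x x" for x using pos_definite_inner_nonneg[OF P] by (simp add: q_def)
  have pos: "0 < q x x" if "x \<noteq> 0" for x using that P by (simp add: q_def pos_definite_def)
  have q_add: "q (x + y) (x + y) = q x x + 2 * q x y + q y y" for x y
    using sym[of x y] by (simp add: q_def matrix_vector_right_distrib inner_add_left inner_add_right)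
  have q_scale: "q x (c *\<^sub>R y) = c * q x y" "q (c *\<^sub>R x) y = c * q x y" for c x y
    by (simp_all add: q_def matrix_vector_mult_scaleR)
  have CS: "(q x y)\<^sup>2 \<le> q x x * q y y"
  proof (cases "y = 0")
    case True then show ?thesis by (simp add: q_def)
  next
    case False
    \<comment> \<open>The minimizer of \<open>q (x + t *\<^sub>R y) (x + t *\<^sub>R y)\<close> over
      \<open>t\<close>.\<close>
    define t where "t = - q x y / q y y"
    have "0 \<le> q (x + t *\<^sub>R y) (x + t *\<^sub>R y)" by (rule nn)
    also have "\<dots> = q x x - (q x y)\<^sup>2 / q y y"
      unfolding q_add q_scale using pos[OF False] by (simp add: t_def power2_eq_square field_simps)
    finally show ?thesis using pos[OF False] by (simp add: field_simps)
  qed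
  have "q x y \<le> sqrt (q x x) * sqrt (q y y)"
    using real_le_rsqrt[OF CS] by (simp add: real_sqrt_mult)
  then have "q (x + y) (x + y) \<le> (sqrt (q x x) + sqrt (q y y))\<^sup>2"
    using nn[of x] nn[of y] by (simp add: q_add power2_sum)
  then show ?thesis
    using nn by (simp add: norm_wrt_def q_def[symmetric] real_le_lsqrt)
qed

text \<open>By homogeneity only the unit sphere matters, and there compactness provides a positive
  minimum and a maximum.\<close>

lemma norm_wrt_bounds:
  fixes P :: "real^'n^'n"
  assumes P: "pos_definite P"
  obtains a b where "0 < a" "0 < b" "\<And>x. a * norm x \<le> norm_wrt P x" "\<And>x. norm_wrt P x \<le> b * norm x"
proof -
  have scale: "norm_wrt P (c *\<^sub>R x) = \<bar>c\<bar> * norm_wrt P x" for c x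
    by (simp add: norm_wrt_def matrix_vector_mult_scaleR real_sqrt_mult mult.assoc[symmetric])
  have cont: "continuous_on (sphere 0 1) (norm_wrt P)"
    unfolding norm_wrt_def
    by (intro continuous_intros linear_continuous_on bounded_linear.linear matrix_vector_mul_bounded_linear)
  have ne: "sphere (0::real^'n) 1 \<noteq> {}" by simp
  obtain u where u: "u \<in> sphere 0 1" "\<And>x. x \<in> sphere 0 1 \<Longrightarrow> norm_wrt P u \<le> norm_wrt P x"
    using continuous_attains_inf[OF compact_sphere ne cont] by auto
  obtain v where v: "v \<in> sphere 0 1" "\<And>x. x \<in> sphere 0 1 \<Longrightarrow> norm_wrt P x \<le> norm_wrt P v"
    using continuous_attains_sup[OF compact_sphere ne cont] by auto
  have u0: "0 < norm_wrt P u"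
    using u(1) P by (cases "u = 0") (auto simp: norm_wrt_def pos_definite_def)
  have eq: "norm_wrt P x = norm x * norm_wrt P (x /\<^sub>R norm x)" for x
    by (cases "x = 0") (simp_all add: scale, simp add: norm_wrt_def)
  show thesis
  proof
    show "0 < norm_wrt P u" "0 < norm_wrt P v" using u0 u(2)[OF v(1)] by auto
    fix x :: "real^'n"
    show "norm_wrt P u * norm x \<le> norm_wrt P x"
      by (cases "x = 0") (simp add: norm_wrt_def, subst eq,
        auto simp: mult.commute intro!: u(2) mult_left_mono)
    show "norm_wrt P x \<le> norm_wrt P v * norm x"
      by (cases "x = 0") (simp add: norm_wrt_def, subst eq,
        auto simp: mult.commute intro!: v(2) mult_left_mono)
  qed
qed

section \<open>Exponential decay of two coupled error sequences\<close>

text \<open>The weighted sum \<open>V\<close> contracts: half of the decay \<open>\<eta> * m\<close>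
  of \<open>a\<close> pays for its influence on \<open>e\<close>, and for small
  \<open>\<eta>\<close> the gap \<open>1 - \<rho>\<close> pays for the influence of \<open>e\<close>
  on \<open>a\<close>. The threshold \<open>\<eta>0\<close> is fixed before the sequences, so one
  step size serves all initial conditions.\<close>

lemma small_gain:
  fixes m c \<rho> :: real
  assumes "0 < m" "0 < c" "0 \<le> \<rho>" "\<rho> < 1"
  obtains \<eta>0 where "0 < \<eta>0"
    "\<And>\<eta> a e. 0 < \<eta> \<Longrightarrow> \<eta> \<le> \<eta>0 \<Longrightarrow>
      (\<And>k::nat. 0 \<le> a k \<and> 0 \<le> e k \<and> a (Suc k) \<le> (1 - \<eta> * m) * a k + \<eta> * c * e k \<and>
           e (Suc k) \<le> (\<rho> + \<eta> * c) * e k + \<eta> * c * a k) \<Longrightarrow>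
      \<exists>C r. 0 \<le> C \<and> 0 \<le> r \<and> r < 1 \<and> (\<forall>k. a k \<le> C * r ^ k \<and> e k \<le> C * r ^ k)"
proof -
  \<comment> \<open>Chosen so that \<open>\<eta> * c + \<eta> * c / l\<close> is at most half of the
    gap \<open>1 - \<rho>\<close>.\<close>
  define \<eta>0 where "\<eta>0 = (1 - \<rho>) / (2 * (c + 2 * c\<^sup>2 / m))"
  have den: "0 < c + 2 * c\<^sup>2 / m" using assms by (simp add: add_pos_pos)
  \<comment> \<open>With this weight \<open>l * (\<eta> * c)\<close> is exactly
    \<open>\<eta> * m / 2\<close>.\<close>
  define l where "l = m / (2 * c)"
  have l: "0 < l" using assms by (simp add: l_def)
  show thesis
  proof
    show "0 < \<eta>0" using den assms by (simp add: \<eta>0_def)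
    fix \<eta> :: real and a e :: "nat \<Rightarrow> real"
    assume \<eta>: "0 < \<eta>" "\<eta> \<le> \<eta>0"
      and step: "\<And>k. 0 \<le> a k \<and> 0 \<le> e k \<and> a (Suc k) \<le> (1 - \<eta> * m) * a k + \<eta> * c * e k \<and>
           e (Suc k) \<le> (\<rho> + \<eta> * c) * e k + \<eta> * c * a k"
    \<comment> \<open>The first entry is the rate left for \<open>a\<close>, the second the rate
      left for \<open>e\<close>; the second also keeps \<open>r\<close> nonnegative.\<close>
    define r where "r = max (1 - \<eta> * m / 2) ((1 + \<rho>) / 2)"
    have r: "0 \<le> r" "r < 1" using assms \<eta> by (auto simp: r_def max_def)
    define V where "V k = a k + l * e k" for k
    have bnd: "\<rho> + \<eta> * c + \<eta> * c / l \<le> r"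
    proof -
      have "\<eta> * (c + 2 * c\<^sup>2 / m) \<le> (1 - \<rho>) / 2"
        using \<eta>(2) den by (simp add: \<eta>0_def pos_le_divide_eq algebra_simps)
      moreover have "\<eta> * c + \<eta> * c / l = \<eta> * (c + 2 * c\<^sup>2 / m)"
        using assms by (simp add: l_def field_simps power2_eq_square)
      moreover have "(1 + \<rho>) / 2 \<le> r" by (simp add: r_def)
      ultimately show ?thesis by argo
    qed
    have V: "V (Suc k) \<le> r * V k" for k
    proof -
      have "V (Suc k) \<le> ((1 - \<eta> * m) * a k + \<eta> * c * e k) + l * ((\<rho> + \<eta> * c) * e k + \<eta> * c * a k)"
        unfolding V_def using step[of k] l by (intro add_mono mult_left_mono) auto
      also have "\<dots> = (1 - \<eta> * m / 2) * a k + (\<rho> + \<eta> * c + \<eta> * c / l) * (l * e k)"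
        using assms by (simp add: l_def field_simps)
      also have "\<dots> \<le> r * a k + r * (l * e k)"
        using step[of k] l bnd by (intro add_mono mult_right_mono) (auto simp: r_def)
      finally show ?thesis by (simp add: V_def algebra_simps)
    qed
    have Vk: "V k \<le> V 0 * r ^ k" for k
    proof (induction k)
      case (Suc k)
      have "V (Suc k) \<le> r * (V 0 * r ^ k)" using V[of k] mult_left_mono[OF Suc r(1)] by linarith
      then show ?case by (simp add: mult_ac)
    qed simp
    have V0: "0 \<le> V 0" using step[of 0] l by (simp add: V_def)
    define C where "C = V 0 + V 0 / l"
    have "a k \<le> C * r ^ k \<and> e k \<le> C * r ^ k" for k
    proof
      have rk: "0 \<le> r ^ k" using r by simp
      have "a k \<le> V k" using step[of k] l by (simp add: V_def)
      also have "\<dots> \<le> V 0 * r ^ k" by (rule Vk)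
      also have "\<dots> \<le> C * r ^ k" using V0 l rk by (intro mult_right_mono) (auto simp: C_def)
      finally show "a k \<le> C * r ^ k" .
      have "l * e k \<le> V k" using step[of k] by (simp add: V_def)
      also have "\<dots> \<le> V 0 * r ^ k" by (rule Vk)
      finally have "e k \<le> V 0 / l * r ^ k" using l by (simp add: field_simps)
      also have "\<dots> \<le> C * r ^ k" using V0 l rk by (intro mult_right_mono) (auto simp: C_def)
      finally show "e k \<le> C * r ^ k" .
    qed
    moreover have "0 \<le> C" using V0 l by (simp add: C_def)
    ultimately show "\<exists>C r. 0 \<le> C \<and> 0 \<le> r \<and> r < 1 \<and> (\<forall>k. a k \<le> C * r ^ k \<and> e k \<le> C * r ^ k)"
      using r by blast
  qed
qed

section \<open>Gradient monotonicity, block vectors and the inner iteration\<close>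

lemma strongly_monotone_grad:
  fixes f :: "'a::euclidean_space \<Rightarrow> real"
  assumes "f \<in> S_class \<mu> \<beta>"
  shows "\<mu> * (norm (x - y))\<^sup>2 \<le> (grad f x - grad f y) \<bullet> (x - y)"
  using S_class_lower_bound[OF assms, of x y] S_class_lower_bound[OF assms, of y x]
  by (simp add: norm_minus_commute inner_diff_left inner_diff_right)

lemma transpose_inner:
  fixes A :: "real^'n^'m"
  shows "(transpose A *v y) \<bullet> x = y \<bullet> (A *v x)"
  by (simp add: dot_lmul_matrix[symmetric])

lemma inner_stack: "stack a b \<bullet> stack c d = a \<bullet> c + b \<bullet> (d :: real^'n)"
  by (simp add: inner_vec_def stack_def sum_UNIV_plus)

lemma mat_mult_vector: "mat c *v x = c *\<^sub>R (x :: real^'n)"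
  by (simp add: vec_eq_iff matrix_vector_mult_def mat_def if_distrib[of "\<lambda>a. a * _"] cong: if_cong)

lemma sec_iff:
  "(v, w) \<in> sec \<mu> \<beta> \<longleftrightarrow> w \<bullet> w \<le> (\<mu> + \<beta>) * (w \<bullet> v) - \<mu> * \<beta> * (v \<bullet> v)"
proof -
  have "(v, w) \<in> sec \<mu> \<beta> \<longleftrightarrow>
      0 \<le> 2 * ((\<mu> + \<beta>) * (w \<bullet> v) - \<mu> * \<beta> * (v \<bullet> v) - w \<bullet> w)"
    by (simp add: sec_def block_matrix_mult_stack inner_stack mat_mult_vector
        inner_commute[of w v] algebra_simps)
  then show ?thesis by argo
qed

text \<open>In every block row the coefficients sum to 1, so a pair of equal blocks is stationary
  and is read off unchanged by both outputs.\<close>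

lemma io_stack:
  "A_io c *v stack y y = stack y (y :: real^'m)"
  "C_io c *v stack y y = y" "E_io c *v stack y y = y"
  by (simp_all add: A_io_def C_io_def E_io_def block_matrix_mult_stack row_block_mult_stack
      mat_mult_vector algebra_simps)

lemma norm_stack_same_le: "norm (stack d d :: real^('m + 'm)) \<le> 2 * norm (d :: real^'m)"
proof (rule power2_le_imp_le)
  show "(norm (stack d d))\<^sup>2 \<le> (2 * norm d)\<^sup>2"
    by (simp add: power_mult_distrib power2_norm_eq_inner inner_stack)
qed simp

lemma stack_diff: "stack a b - stack c d = stack (a - c) (b - d :: real^'n)"
  by (simp add: vec_eq_iff stack_def split: sum.split)

text \<open>Since \<open>A_io c1\<close> fixes \<open>stack u u\<close>, the deviation from it obeys
  the same linear recursion, now driven by a gradient difference. With \<open>grad g u\<close> equal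
  to \<open>A *v x k\<close>, this is one inner step for frozen \<open>x k\<close>.\<close>

lemma io_tracking:
  fixes g :: "real^'m \<Rightarrow> real"
  assumes "g \<in> S_class \<mu> \<beta>" "\<mu> \<le> \<beta>"
    and contr: "\<And>(\<xi> :: real^('m + 'm)) (w :: real^'m). (C_io c2 *v \<xi>, w) \<in> sec \<mu> \<beta> \<Longrightarrow>
        norm_wrt P (A_io c1 *v \<xi> + B_io \<eta> *v w) \<le> \<rho> * norm_wrt P \<xi>"
  shows "norm_wrt P (A_io c1 *v \<xi> + B_io \<eta> *v (grad g (C_io c2 *v \<xi>) - grad g u) - stack u u)
     \<le> \<rho> * norm_wrt P (\<xi> - stack u u)"
proof -
  define w where "w = grad g (C_io c2 *v \<xi>) - grad g u"
  have v: "C_io c2 *v (\<xi> - stack u u) = C_io c2 *v \<xi> - u"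
    by (simp add: matrix_vector_mult_diff_distrib io_stack)
  have "(C_io c2 *v (\<xi> - stack u u), w) \<in> sec \<mu> \<beta>"
    unfolding sec_iff v w_def by (rule S_class_cocoercive[OF assms(1,2)])
  from contr[OF this] show ?thesis
    by (simp add: matrix_vector_mult_diff_distrib io_stack w_def algebra_simps)
qed

section \<open>Saddle points and uniqueness of the optima\<close>

text \<open>The stationarity equations make \<open>(xs, ys)\<close> a saddle point of value
  \<open>S\<close>. Dual uniqueness comes from the quadratic loss in \<open>y\<close>. As
  \<open>f\<close> is merely convex, primal uniqueness comes from \<open>A\<close>: at an optimal
  \<open>x\<close> the point \<open>ys\<close> still maximizes over \<open>y\<close>, which forces
  \<open>A *v x = grad g ys\<close>.\<close>

lemma saddle_point_unique_optima:
  fixes f :: "real^'n \<Rightarrow> real" and g :: "real^'m \<Rightarrow> real" and A :: "real^'n^'m"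
  assumes f: "f \<in> S_class 0 \<beta>f" and g: "g \<in> S_class \<mu> \<beta>" and "0 < \<mu>" "0 < \<beta>"
    and inj: "inj ((*v) A)"
    and xs: "grad f xs + transpose A *v ys = 0" and ys: "grad g ys = A *v xs"
  shows "primal_optimal f g A x \<longleftrightarrow> x = xs" and "dual_optimal f g A y \<longleftrightarrow> y = ys"
proof -
  define S where "S = Lagr f g A xs ys"
  have upper: "Lagr f g A xs y \<le> S - \<mu> / 2 * (norm (y - ys))\<^sup>2" for y
    using S_class_lower_bound[OF g, of ys y] ys
    by (simp add: S_def Lagr_def inner_diff_right inner_commute)
  have upper': "Lagr f g A xs y \<le> S" for y
    using upper[of y] \<open>0 < \<mu>\<close> by (smt (verit) divide_pos_pos mult_nonneg_nonneg zero_le_power2)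
  have lower: "S \<le> Lagr f g A x ys" for x
  proof -
    have "grad f xs \<bullet> (x - xs) = - (ys \<bullet> (A *v (x - xs)))"
      using xs by (simp add: transpose_inner[symmetric] eq_neg_iff_add_eq_0 inner_add_left[symmetric])
    then show ?thesis
      using S_class_lower_bound[OF f, of xs x]
      by (simp add: S_def Lagr_def matrix_vector_mult_diff_distrib inner_diff_right)
  qed
  have p_xs: "primal_fun f g A xs \<le> ereal S"
    using upper' by (auto simp: primal_fun_def intro!: SUP_least)
  have p_ge: "ereal (Lagr f g A x y) \<le> primal_fun f g A x" for x y
    unfolding primal_fun_def by (rule SUP_upper) simp
  have d_ys: "ereal S \<le> dual_fun f g A ys"
    using lower by (auto simp: dual_fun_def intro!: INF_greatest)
  have d_le: "dual_fun f g A y \<le> ereal (Lagr f g A x y)" for x y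
    unfolding dual_fun_def by (rule INF_lower) simp
  show "primal_optimal f g A x \<longleftrightarrow> x = xs"
  proof
    assume "x = xs"
    then show "primal_optimal f g A x"
      using order_trans[OF p_xs order_trans[OF _ p_ge[of _ ys]]] lower
      by (simp add: primal_optimal_def)
  next
    assume "primal_optimal f g A x"
    then have "primal_fun f g A x \<le> ereal S"
      using order_trans[OF _ p_xs] by (simp add: primal_optimal_def)
    then have "ereal (Lagr f g A x y) \<le> ereal S" for y
      by (rule order_trans[OF p_ge])
    then have le: "Lagr f g A x y \<le> Lagr f g A x ys" for y
      using order_trans[OF _ lower] by simp
    \<comment> \<open>A gradient step on \<^term>\<open>g\<close> from the maximizer \<^term>\<open>ys\<close> would increase \<^term>\<open>Lagr f g A x\<close>.\<close>
    define d where "d = A *v x - grad g ys"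
    define t where "t = 1 / \<beta>"
    have "(ys + t *\<^sub>R d) \<bullet> (A *v x) - ys \<bullet> (A *v x) \<le> grad g ys \<bullet> (t *\<^sub>R d) + \<beta> / 2 * (norm (t *\<^sub>R d))\<^sup>2"
      using le[of "ys + t *\<^sub>R d"] S_class_upper_bound[OF g, of "ys + t *\<^sub>R d" ys]
      by (simp add: Lagr_def)
    then have "t * (d \<bullet> d) \<le> \<beta> / 2 * t\<^sup>2 * (d \<bullet> d)"
      unfolding power2_norm_eq_inner
      by (simp add: d_def inner_add_left inner_diff_left inner_diff_right inner_commute algebra_simps power2_eq_square)
    then have "d \<bullet> d \<le> 0"
      using \<open>0 < \<beta>\<close> by (simp add: t_def power2_eq_square field_simps)
    then have "d = 0" by (meson inner_gt_zero_iff not_le)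
    then show "x = xs" using ys inj by (simp add: d_def inj_eq)
  qed
  show "dual_optimal f g A y \<longleftrightarrow> y = ys"
  proof
    assume "y = ys"
    then show "dual_optimal f g A y"
      using order_trans[OF order_trans[OF d_le[of _ xs]] d_ys] upper'
      by (simp add: dual_optimal_def)
  next
    assume "dual_optimal f g A y"
    then have "ereal S \<le> dual_fun f g A y"
      using order_trans[OF d_ys] by (simp add: dual_optimal_def)
    then have "ereal S \<le> ereal (Lagr f g A xs y)"
      by (rule order_trans[OF _ d_le])
    then have "\<mu> / 2 * (norm (y - ys))\<^sup>2 \<le> 0" using upper[of y] by simp
    then show "y = ys" using \<open>0 < \<mu>\<close> by (simp add: mult_le_0_iff)
  qed
qed

section \<open>Convergence of the coupled iteration\<close>

lemma converges_exponentiallyI: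
  assumes "\<And>k. norm (z k - zs) \<le> K * a k + M * e k" "0 \<le> K" "0 \<le> M"
    and "0 \<le> C" "0 \<le> r" "r < 1" "\<And>k. a k \<le> C * r ^ k \<and> e k \<le> C * r ^ k"
  shows "converges_exponentially z zs"
  unfolding converges_exponentially_def
proof (intro exI conjI allI)
  show "0 \<le> (K + M) * C" using assms by simp
  fix k
  have "K * a k + M * e k \<le> K * (C * r ^ k) + M * (C * r ^ k)"
    using assms by (intro add_mono mult_left_mono) auto
  then show "norm (z k - zs) \<le> (K + M) * C * r ^ k"
    using assms(1)[of k] by (simp add: algebra_simps)
qed fact+

theorem theorem10:
  fixes f :: "real^'n \<Rightarrow> real" and g :: "real^'m \<Rightarrow> real" and A :: "real^'n^'m"
    and \<beta>f \<mu>g \<beta>g c1 c2 c3 \<eta>2 :: real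
  assumes "0 < \<beta>f" and "f \<in> S_class 0 \<beta>f"
    and "0 < \<mu>g" and "\<mu>g \<le> \<beta>g" and "g \<in> S_class \<mu>g \<beta>g"
    and "rank A = CARD('n)"
    and "0 < \<eta>2"
    and "\<exists>(P :: real^('m + 'm)^('m + 'm)) \<rho>2. pos_definite P \<and> 0 \<le> \<rho>2 \<and> \<rho>2 < 1 \<and>
           (\<forall>(\<xi> :: real^('m + 'm)) (w :: real^'m). (C_io c2 *v \<xi>, w) \<in> sec \<mu>g \<beta>g \<longrightarrow>
              norm_wrt P (A_io c1 *v \<xi> + B_io \<eta>2 *v w) \<le> \<rho>2 * norm_wrt P \<xi>)"
  shows "\<exists>xs ys.
           (\<forall>x. primal_optimal f g A x \<longleftrightarrow> x = xs) \<and>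
           (\<forall>y. dual_optimal f g A y \<longleftrightarrow> y = ys) \<and>
           (\<exists>\<eta>1 > 0. \<forall>(x0 :: real^'n) (\<xi>0 :: real^('m + 'm))
               (x :: nat \<Rightarrow> real^'n) (\<xi> :: nat \<Rightarrow> real^('m + 'm))
               (v :: nat \<Rightarrow> real^'m) (y :: nat \<Rightarrow> real^'m).
              x 0 = x0 \<and> \<xi> 0 = \<xi>0 \<and>
              (\<forall>k. x (Suc k) = x k - \<eta>1 *\<^sub>R (grad f (x k) + transpose A *v y k) \<and>
                   \<xi> (Suc k) = A_io c1 *v \<xi> k + B_io \<eta>2 *v (grad g (v k) - A *v x k) \<and>
                   v k = C_io c2 *v \<xi> k \<and>
                   y k = E_io c3 *v \<xi> k) \<longrightarrow>
              converges_exponentially x xs \<and> converges_exponentially y ys)"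
proof -
  note f = assms(2) and g = assms(5)
  have \<beta>g: "0 < \<beta>g" using assms(3,4) by linarith
  have inj: "inj ((*v) A)" using assms(6) by (simp add: full_rank_injective)
  obtain P :: "real^('m + 'm)^('m + 'm)" and \<rho> where P: "pos_definite P" and \<rho>: "0 \<le> \<rho>" "\<rho> < 1"
    and contr: "\<And>\<xi> w. (C_io c2 *v \<xi>, w) \<in> sec \<mu>g \<beta>g \<Longrightarrow>
        norm_wrt P (A_io c1 *v \<xi> + B_io \<eta>2 *v w) \<le> \<rho> * norm_wrt P \<xi>"
    using assms(8) by blast
  obtain pl pu where pl: "0 < pl" "\<And>x. pl * norm x \<le> norm_wrt P x"
    and pu: "0 < pu" "\<And>x. norm_wrt P x \<le> pu * norm x"
    using norm_wrt_bounds[OF P] by metis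
  \<comment> \<open>Full column rank in quantitative form.\<close>
  obtain s where s: "0 < s" "\<And>x. s * norm x \<le> norm (A *v x)"
    using linear_inj_bounded_below_pos[OF _ inj] by (metis matrix_vector_mul_linear)
  obtain KA where KA: "0 < KA" "\<And>x. norm (A *v x) \<le> norm x * KA"
    using bounded_linear.pos_bounded[OF matrix_vector_mul_bounded_linear[of A]] by auto
  obtain KT where KT: "0 < KT" "\<And>x. norm (transpose A *v x) \<le> norm x * KT"
    using bounded_linear.pos_bounded[OF matrix_vector_mul_bounded_linear[of "transpose A"]] by auto
  obtain KE where KE: "0 < KE" "\<And>x. norm ((E_io c3 :: real^('m+'m)^'m) *v x) \<le> norm x * KE"
    using bounded_linear.pos_bounded[OF matrix_vector_mul_bounded_linear[of "E_io c3 :: real^('m+'m)^'m"]] by auto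

  have lip_grad: "norm (grad f x - grad f y) \<le> \<beta>f * norm (x - y)" for x y
    using f lipschitz_onD[of \<beta>f UNIV "grad f" x y] by (auto simp: S_class_def dist_norm)
  have lip_grad_g: "norm (grad g x - grad g y) \<le> \<beta>g * norm (x - y)" for x y
    using g lipschitz_onD[of \<beta>g UNIV "grad g" x y] by (auto simp: S_class_def dist_norm)
  \<comment> \<open>The preimage \<open>\<phi> (A *v x)\<close> chosen below is the maximizer of
    \<open>Lagr f g A x\<close>.\<close>
  have "\<exists>u. grad g u = b" for b
    using strongly_monotone_surj[of \<mu>g "grad g", OF strongly_monotone_grad[OF g] lip_grad_g assms(3)] by metis
  then obtain \<phi> where \<phi>: "\<And>b. grad g (\<phi> b) = b" by metis
  have lip_\<phi>: "norm (\<phi> b - \<phi> c) \<le> norm (b - c) / \<mu>g" for b c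
  proof (cases "\<phi> b = \<phi> c")
    case False
    have "\<mu>g * (norm (\<phi> b - \<phi> c))\<^sup>2 \<le> (b - c) \<bullet> (\<phi> b - \<phi> c)"
      using strongly_monotone_grad[OF g, of "\<phi> b" "\<phi> c"] by (simp add: \<phi>)
    also have "\<dots> \<le> norm (b - c) * norm (\<phi> b - \<phi> c)" by (rule norm_cauchy_schwarz)
    finally show ?thesis using False assms(3) by (simp add: power2_eq_square field_simps)
  qed (use assms(3) in simp)
  define \<kappa> where "\<kappa> = KA / \<mu>g"
  have \<kappa>: "0 < \<kappa>" using KA assms(3) by (simp add: \<kappa>_def)
  have lip_\<phi>A: "norm (\<phi> (A *v x) - \<phi> (A *v x')) \<le> \<kappa> * norm (x - x')" for x x'
  proof -
    have "norm (A *v x - A *v x') \<le> norm (x - x') * KA"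
      using KA(2)[of "x - x'"] by (simp add: matrix_vector_mult_diff_distrib)
    then have "norm (A *v x - A *v x') / \<mu>g \<le> (norm (x - x') * KA) / \<mu>g"
      using assms(3) by (intro divide_right_mono) auto
    with lip_\<phi>[of "A *v x" "A *v x'"] show ?thesis by (simp add: \<kappa>_def mult.commute)
  qed

  define F where "F x = grad f x + transpose A *v \<phi> (A *v x)" for x
  \<comment> \<open>The modulus comes from the dual term: cocoercivity contributes
    \<open>1 / (\<mu>g + \<beta>g)\<close> and the lower bound on \<open>A\<close> contributes
    \<open>s\<^sup>2\<close>.\<close>
  define m where "m = s\<^sup>2 / (\<mu>g + \<beta>g)"
  have m: "0 < m" using s assms(3) \<beta>g by (simp add: m_def)
  define L where "L = max m (\<beta>f + \<kappa> * KT)"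
  have mono_F: "m * (norm (x - x'))\<^sup>2 \<le> (F x - F x') \<bullet> (x - x')" for x x'
  proof -
    define u where "u = \<phi> (A *v x) - \<phi> (A *v x')"
    define b where "b = A *v (x - x')"
    have b: "b = grad g (\<phi> (A *v x)) - grad g (\<phi> (A *v x'))"
      by (simp add: \<phi> b_def matrix_vector_mult_diff_distrib)
    have "b \<bullet> b \<le> (\<mu>g + \<beta>g) * (b \<bullet> u) - \<mu>g * \<beta>g * (u \<bullet> u)"
      unfolding b u_def by (rule S_class_cocoercive[OF g assms(4)])
    also have "\<dots> \<le> (\<mu>g + \<beta>g) * (b \<bullet> u)" using assms(3) \<beta>g by simp
    finally have "(norm b)\<^sup>2 \<le> (\<mu>g + \<beta>g) * (u \<bullet> b)" by (simp add: power2_norm_eq_inner inner_commute)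
    moreover have "(s * norm (x - x'))\<^sup>2 \<le> (norm b)\<^sup>2"
      using s unfolding b_def by (intro power_mono) auto
    ultimately have "m * (norm (x - x'))\<^sup>2 \<le> u \<bullet> b"
      using assms(3) \<beta>g by (simp add: m_def power_mult_distrib field_simps)
    also have "\<dots> = (transpose A *v u) \<bullet> (x - x')" by (simp only: transpose_inner b_def)
    also have "\<dots> \<le> (grad f x - grad f x') \<bullet> (x - x') + (transpose A *v u) \<bullet> (x - x')"
      using strongly_monotone_grad[OF f, of x x'] by simp
    also have "\<dots> = (F x - F x') \<bullet> (x - x')"
      by (simp add: F_def u_def matrix_vector_mult_diff_distrib inner_add_left inner_diff_left)
    finally show ?thesis .
  qed
  have lip_F: "norm (F x - F x') \<le> L * norm (x - x')" for x x'
  proof -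
    have "F x - F x' = (grad f x - grad f x') + transpose A *v (\<phi> (A *v x) - \<phi> (A *v x'))"
      by (simp add: F_def matrix_vector_mult_diff_distrib)
    then have "norm (F x - F x') \<le> norm (grad f x - grad f x') + norm (transpose A *v (\<phi> (A *v x) - \<phi> (A *v x')))"
      by (metis norm_triangle_ineq)
    also have "\<dots> \<le> \<beta>f * norm (x - x') + (\<kappa> * norm (x - x')) * KT"
      using lip_grad KT lip_\<phi>A by (intro add_mono order_trans[OF KT(2)] mult_right_mono) auto
    also have "\<dots> = (\<beta>f + \<kappa> * KT) * norm (x - x')" by (simp add: algebra_simps)
    also have "\<dots> \<le> L * norm (x - x')" by (intro mult_right_mono) (auto simp: L_def)
    finally show ?thesis .
  qed
  obtain xs where xs: "F xs = 0" using strongly_monotone_surj[OF mono_F lip_F m] by metis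
  define ys where "ys = \<phi> (A *v xs)"
  note optima = saddle_point_unique_optima[OF f g assms(3) \<beta>g inj, of xs ys]

  \<comment> \<open>Bounds the perturbation of the gradient step per unit of tracking error:
    \<open>pl\<close> leaves the \<open>P\<close>-norm, \<open>KE\<close> passes the output matrix,
    \<open>KT\<close> the transpose of \<open>A\<close>.\<close>
  define q where "q = KE * KT / pl"
  \<comment> \<open>One constant dominating every coupling coefficient: \<open>q\<close> for the
    perturbed \<open>x\<close>-update, and \<open>2 * pu * \<kappa>\<close> times \<open>L\<close>
    or \<open>q\<close> for the drift of the target.\<close>
  define c where "c = q + 2 * pu * \<kappa> * (L + q)"
  have L: "0 < L" "m \<le> L" using m by (auto simp: L_def)
  have q: "0 < q" using KE KT pl by (simp add: q_def)
  have c': "0 < 2 * pu * \<kappa>" using pu \<kappa> by simp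
  have c: "0 < c" "q \<le> c" "2 * pu * \<kappa> * L \<le> c" "2 * pu * \<kappa> * q \<le> c"
    using q c' L unfolding c_def distrib_left
    by (smt (verit) mult_pos_pos)+
  have "0 < m / 2" using m by simp
  from small_gain[OF this c(1) \<rho>] obtain \<eta>0 where \<eta>0: "0 < \<eta>0"
    and decay: "\<And>\<eta> a e. 0 < \<eta> \<Longrightarrow> \<eta> \<le> \<eta>0 \<Longrightarrow>
      (\<And>k::nat. 0 \<le> a k \<and> 0 \<le> e k \<and> a (Suc k) \<le> (1 - \<eta> * (m / 2)) * a k + \<eta> * c * e k \<and>
           e (Suc k) \<le> (\<rho> + \<eta> * c) * e k + \<eta> * c * a k) \<Longrightarrow>
      \<exists>C r. 0 \<le> C \<and> 0 \<le> r \<and> r < 1 \<and> (\<forall>k. a k \<le> C * r ^ k \<and> e k \<le> C * r ^ k)"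
    by metis
  \<comment> \<open>The first bound serves the decay argument, the second the gradient step.\<close>
  define \<eta> where "\<eta> = min \<eta>0 (m / L\<^sup>2)"
  have \<eta>: "0 < \<eta>" "\<eta> \<le> \<eta>0" "\<eta> \<le> m / L\<^sup>2" using \<eta>0 m L by (auto simp: \<eta>_def)

  have conv: "converges_exponentially x xs \<and> converges_exponentially y ys"
    if x: "\<And>k. x (Suc k) = x k - \<eta> *\<^sub>R (grad f (x k) + transpose A *v y k)"
      and \<xi>: "\<And>k. \<xi> (Suc k) = A_io c1 *v \<xi> k + B_io \<eta>2 *v (grad g (C_io c2 *v \<xi> k) - A *v x k)"
      and y: "\<And>k. y k = E_io c3 *v \<xi> k"
    for x :: "nat \<Rightarrow> real^'n" and \<xi> :: "nat \<Rightarrow> real^('m + 'm)" and y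
  proof -
    define u where "u k = \<phi> (A *v x k)" for k
    define a where "a k = norm (x k - xs)" for k
    define e where "e k = norm_wrt P (\<xi> k - stack (u k) (u k))" for k
    define \<delta> where "\<delta> k = y k - u k" for k
    have e0: "0 \<le> e k" for k using norm_wrt_nonneg[OF P] by (simp add: e_def)
    have \<delta>: "norm (\<delta> k) \<le> KE / pl * e k" for k
    proof -
      have "\<delta> k = E_io c3 *v (\<xi> k - stack (u k) (u k))"
        by (simp add: \<delta>_def y matrix_vector_mult_diff_distrib io_stack)
      then have "norm (\<delta> k) \<le> norm (\<xi> k - stack (u k) (u k)) * KE" by (simp add: KE)
      moreover have "norm (\<xi> k - stack (u k) (u k)) \<le> e k / pl"
        using pl(2)[of "\<xi> k - stack (u k) (u k)"] pl(1) by (simp add: e_def field_simps)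
      ultimately show ?thesis using KE(1)
        by (smt (verit) mult_right_mono times_divide_eq_left mult.commute)
    qed
    have \<delta>T: "norm (transpose A *v \<delta> k) \<le> q * e k" for k
      using order_trans[OF KT(2) mult_right_mono[OF \<delta>, of KT]] KT by (simp add: q_def mult_ac)
    have step: "x (Suc k) = x k - \<eta> *\<^sub>R F (x k) - \<eta> *\<^sub>R (transpose A *v \<delta> k)" for k
      by (simp add: x F_def \<delta>_def u_def matrix_vector_mult_diff_distrib algebra_simps)
    have a_step: "a (Suc k) \<le> (1 - \<eta> * (m / 2)) * a k + \<eta> * q * e k" for k
    proof -
      have "x (Suc k) - xs = ((x k - \<eta> *\<^sub>R F (x k)) - (xs - \<eta> *\<^sub>R F xs)) - \<eta> *\<^sub>R (transpose A *v \<delta> k)"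
        by (simp add: step xs)
      then have "a (Suc k) \<le> norm ((x k - \<eta> *\<^sub>R F (x k)) - (xs - \<eta> *\<^sub>R F xs)) + norm (\<eta> *\<^sub>R (transpose A *v \<delta> k))"
        unfolding a_def by (metis norm_triangle_ineq4)
      also have "\<dots> \<le> (1 - \<eta> * m / 2) * norm (x k - xs) + \<eta> * (q * e k)"
        using gradient_step_contraction[of m "x k" xs F L \<eta>, OF mono_F lip_F m L(2) \<eta>(1,3)] \<delta>T[of k] \<eta>(1)
        by (intro add_mono) auto
      finally show ?thesis by (simp add: a_def)
    qed
    \<comment> \<open>Because \<open>F xs = 0\<close>, the displacement is controlled by the two
      errors alone, and hence so is the drift of the target.\<close>
    have move: "norm (x (Suc k) - x k) \<le> \<eta> * (L * a k + q * e k)" for k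
    proof -
      have "x (Suc k) - x k = - (\<eta> *\<^sub>R ((F (x k) - F xs) + transpose A *v \<delta> k))"
        by (simp add: step xs algebra_simps)
      then have "norm (x (Suc k) - x k) = \<eta> * norm ((F (x k) - F xs) + transpose A *v \<delta> k)"
        using \<eta>(1) by simp
      also have "\<dots> \<le> \<eta> * (L * a k + q * e k)"
        using lip_F[of "x k" xs] \<delta>T[of k] \<eta>(1) unfolding a_def
        by (intro mult_left_mono norm_triangle_le add_mono) auto
      finally show ?thesis .
    qed
    have e_step: "e (Suc k) \<le> \<rho> * e k + 2 * pu * \<kappa> * (\<eta> * (L * a k + q * e k))" for k
    proof -
      define d where "d = u k - u (Suc k)"
      \<comment> \<open>The deviation from the new target is the deviation from the old one, which
        the sector contraction shrinks, plus the drift, which the Lipschitz bound on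
        \<open>\<phi>\<close> controls.\<close>
      have split: "\<xi> (Suc k) - stack (u (Suc k)) (u (Suc k)) = (\<xi> (Suc k) - stack (u k) (u k)) + stack d d"
        by (simp add: d_def stack_diff[symmetric])
      have "norm_wrt P (\<xi> (Suc k) - stack (u k) (u k)) \<le> \<rho> * e k"
        using io_tracking[OF g assms(4) contr, where \<xi> = "\<xi> k" and u = "u k"] by (simp add: e_def \<xi> u_def \<phi>)
      moreover have "norm_wrt P (stack d d) \<le> pu * (2 * (\<kappa> * (\<eta> * (L * a k + q * e k))))"
      proof -
        have "norm d \<le> \<kappa> * norm (x (Suc k) - x k)"
          using lip_\<phi>A[of "x k" "x (Suc k)"] by (simp add: d_def u_def norm_minus_commute)
        also have "\<dots> \<le> \<kappa> * (\<eta> * (L * a k + q * e k))" using move \<kappa> by (intro mult_left_mono) auto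
        finally have "norm (stack d d) \<le> 2 * (\<kappa> * (\<eta> * (L * a k + q * e k)))"
          using norm_stack_same_le[of d] by linarith
        then show ?thesis
          using pu(1) by (intro order_trans[OF pu(2)] mult_left_mono) auto
      qed
      ultimately show ?thesis
        using norm_wrt_triangle[OF P, of "\<xi> (Suc k) - stack (u k) (u k)" "stack d d"]
        unfolding e_def[of "Suc k"] split by (simp add: mult_ac)
    qed
    have "\<exists>C r. 0 \<le> C \<and> 0 \<le> r \<and> r < 1 \<and> (\<forall>k. a k \<le> C * r ^ k \<and> e k \<le> C * r ^ k)"
    proof (rule decay[OF \<eta>(1,2)])
      fix k
      have a0: "0 \<le> a k" by (simp add: a_def)
      have "\<eta> * q * e k \<le> \<eta> * c * e k" using c e0 \<eta> by (intro mult_right_mono mult_left_mono) auto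
      then have 1: "a (Suc k) \<le> (1 - \<eta> * (m / 2)) * a k + \<eta> * c * e k" using a_step[of k] by linarith
      have "2 * pu * \<kappa> * (\<eta> * (L * a k + q * e k)) = \<eta> * (2 * pu * \<kappa> * L) * a k + \<eta> * (2 * pu * \<kappa> * q) * e k"
        by (simp add: algebra_simps)
      also have "\<dots> \<le> \<eta> * c * a k + \<eta> * c * e k"
        using c e0 a0 \<eta> by (intro add_mono mult_right_mono mult_left_mono) auto
      finally have "e (Suc k) \<le> (\<rho> + \<eta> * c) * e k + \<eta> * c * a k"
        using e_step[of k] by (simp add: algebra_simps)
      with 1 a0 e0 show "0 \<le> a k \<and> 0 \<le> e k \<and> a (Suc k) \<le> (1 - \<eta> * (m / 2)) * a k + \<eta> * c * e k \<and>
           e (Suc k) \<le> (\<rho> + \<eta> * c) * e k + \<eta> * c * a k" by blast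
    qed
    then obtain C r where C: "0 \<le> C" "0 \<le> r" "r < 1" "\<And>k. a k \<le> C * r ^ k \<and> e k \<le> C * r ^ k" by blast
    have "norm (y k - ys) \<le> \<kappa> * a k + KE / pl * e k" for k
    proof -
      have "y k - ys = (u k - ys) + \<delta> k" by (simp add: \<delta>_def)
      moreover have "norm (u k - ys) \<le> \<kappa> * a k" using lip_\<phi>A by (simp add: u_def ys_def a_def)
      ultimately show ?thesis using \<delta>[of k] by (simp only: norm_triangle_le add_mono)
    qed
    then have "converges_exponentially y ys"
      using converges_exponentiallyI[of y ys \<kappa> a "KE / pl" e, OF _ _ _ C] \<kappa> KE(1) pl(1) by simp
    moreover have "converges_exponentially x xs"
      using converges_exponentiallyI[of x xs 1 a 0 e, OF _ _ _ C] by (simp add: a_def)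
    ultimately show ?thesis by blast
  qed
  have kkt: "grad f xs + transpose A *v ys = 0" "grad g ys = A *v xs"
    using xs by (simp_all add: F_def ys_def \<phi>)
  show ?thesis
    by (intro exI[of _ xs] exI[of _ ys] exI[of _ \<eta>] conjI[OF allI conjI[OF allI]] conjI[OF \<eta>(1)]
        optima(1)[OF kkt] optima(2)[OF kkt] allI impI conv) simp_all
qed

end
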